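(* (1) There exists a finite abelian group $D$ equipped with a generalized quadratic form $q:D\to\mathbb{Q}/\mathbb{Z}$ such that $q(0)=0$ but $q$ is not pure. (2) There exists a finite abelian group $D$ equipped with a generalized quadratic form $q:D\to\mathbb{Q}/\mathbb{Z}$ such that $q(0)=0$ but the data $(D,q,C)$ does not lift to any even lattice, where $C$ modulo $8$ is determined from $q$ by the Gauss sum formula $$\frac{1}{\sqrt{|D|}}\sum_{x\in D}\exp(2\pi i\,q(x))=\exp(2\pi i\,C/8).$$
   Context: A generalized quadratic form on a finite abelian group $D$ is a function $q:D\to\mathbb{Q}/\mathbb{Z}$ such that $b(x,y):=q(x+y)-q(x)-q(y)+q(0)$ is a nondegenerate symmetric bilinear form. It is pure if moreover $q(nx)=n^2q(x)$ for all integers $n$ and all $x\in D$. An even lattice $(\Lambda,B)$ is a finitely generated free abelian group $\Lambda$ with a nondegenerate symmetric bilinear form $B:\Lambda\times\Lambda\to\mathbb{Z}$ satisfying $B(X,X)\in2\mathbb{Z}$ for all $X\in\Lambda$. Regarding the dual lattice $\Lambda^*$ as the subgroup $\{v\in\Lambda\otimes\mathbb{Q}: B(v,\Lambda)\subset\mathbb{Z}\}$ of $\Lambda\otimes\mathbb{Q}$, the discriminant group is $\Lambda^*/\Lambda$, and $B$ descends to a nondegenerate symmetric bilinear form $\Lambda^*/\Lambda\times\Lambda^*/\Lambda\to\mathbb{Q}/\mathbb{Z}$. Let $\mathrm{sign}(B)$ denote the signature of $B$. A lift of $(D,q,C)$ to an even lattice means an even lattice $(\Lambda,B)$ with $\mathrm{sign}(B)\equiv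 C\pmod 8$ together with an isomorphism $\Lambda^*/\Lambda\cong D$ under which the bilinear form induced by $B$ corresponds to the bilinear form $b$ of $q$. *)

theory Defs
  imports Complex_Main "HOL-Algebra.Coset" "HOL-Library.Function_Algebras"
begin

quotient_type rat_mod_int = rat / "\<lambda>r s. r - s \<in> \<int>"
proof (rule equivpI)
  show "reflp (\<lambda>r s :: rat. r - s \<in> \<int>)"
    by (simp add: reflp_def)
  show "symp (\<lambda>r s :: rat. r - s \<in> \<int>)"
    unfolding symp_def by (metis Ints_minus minus_diff_eq)
  show "transp (\<lambda>r s :: rat. r - s \<in> \<int>)"
    unfolding transp_def by (metis Ints_add add_diff_eq diff_add_cancel)
qed

instantiation rat_mod_int :: ab_group_add
begin

lift_definition zero_rat_mod_int :: rat_mod_int is 0 .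

lift_definition plus_rat_mod_int :: "rat_mod_int \<Rightarrow> rat_mod_int \<Rightarrow> rat_mod_int" is "(+)"
  by (metis Ints_add add_diff_add)

lift_definition uminus_rat_mod_int :: "rat_mod_int \<Rightarrow> rat_mod_int" is uminus
  by (metis Ints_minus minus_diff_minus)

lift_definition minus_rat_mod_int :: "rat_mod_int \<Rightarrow> rat_mod_int \<Rightarrow> rat_mod_int" is "(-)"
  by (metis Ints_diff diff_diff_eq diff_diff_eq2 add_diff_eq diff_add_eq add.commute)

instance
  by standard (transfer; simp add: algebra_simps)+

end

lift_definition rat_class :: "rat \<Rightarrow> rat_mod_int" is "\<lambda>r. r" .

lift_definition int_mult :: "int \<Rightarrow> rat_mod_int \<Rightarrow> rat_mod_int" is "\<lambda>k r. of_int k * r"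
  by (metis Ints_mult Ints_of_int right_diff_distrib)

lift_definition exp_2pi_i :: "rat_mod_int \<Rightarrow> complex"
  is "\<lambda>r. exp (2 * complex_of_real pi * \<i> * complex_of_real (of_rat r))"
proof -
  fix r s :: rat
  assume "r - s \<in> \<int>"
  then obtain k where "r - s = of_int k"
    by (elim Ints_cases)
  then have "r = s + of_int k"
    by simp
  then have "2 * complex_of_real pi * \<i> * complex_of_real (of_rat r) =
      2 * complex_of_real pi * \<i> * complex_of_real (of_rat s) +
      \<i> * complex_of_real (2 * pi * of_int k)"
    by (simp add: of_rat_add algebra_simps)
  moreover have "exp (\<i> * complex_of_real (2 * pi * of_int k)) = 1"
    using cis_multiple_2pi[of "of_int k"] by (simp add: cis_conv_exp)
  ultimately show "exp (2 * complex_of_real pi * \<i> * complex_of_real (of_rat r)) =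
      exp (2 * complex_of_real pi * \<i> * complex_of_real (of_rat s))"
    by (simp only: exp_add mult_1_right)
qed

text \<open>Abelian groups are written multiplicatively, as usual for \<^locale>\<open>comm_group\<close>; in particular
  \<open>n x\<close> becomes \<open>x [^]\<^bsub>D\<^esub> n\<close>. Functions on a group matter only on its carrier.\<close>

definition assoc_form ::
    "('a, 'm) monoid_scheme \<Rightarrow> ('a \<Rightarrow> rat_mod_int) \<Rightarrow> 'a \<Rightarrow> 'a \<Rightarrow> rat_mod_int" where
  "assoc_form D q x y = q (x \<otimes>\<^bsub>D\<^esub> y) - q x - q y + q \<one>\<^bsub>D\<^esub>"

definition finite_abelian_group :: "('a, 'm) monoid_scheme \<Rightarrow> bool" where
  "finite_abelian_group D \<longleftrightarrow> comm_group D \<and> finite (carrier D)"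

definition nondegenerate_symmetric_bilinear ::
    "('a, 'm) monoid_scheme \<Rightarrow> ('a \<Rightarrow> 'a \<Rightarrow> rat_mod_int) \<Rightarrow> bool" where
  "nondegenerate_symmetric_bilinear D b \<longleftrightarrow>
    (\<forall>x\<in>carrier D. \<forall>y\<in>carrier D. b x y = b y x) \<and>
    (\<forall>x\<in>carrier D. \<forall>y\<in>carrier D. \<forall>z\<in>carrier D. b (x \<otimes>\<^bsub>D\<^esub> y) z = b x z + b y z) \<and>
    (\<forall>x\<in>carrier D. (\<forall>y\<in>carrier D. b x y = 0) \<longrightarrow> x = \<one>\<^bsub>D\<^esub>)"

definition generalized_quadratic_form ::
    "('a, 'm) monoid_scheme \<Rightarrow> ('a \<Rightarrow> rat_mod_int) \<Rightarrow> bool" where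
  "generalized_quadratic_form D q \<longleftrightarrow> nondegenerate_symmetric_bilinear D (assoc_form D q)"

definition pure_quadratic_form ::
    "('a, 'm) monoid_scheme \<Rightarrow> ('a \<Rightarrow> rat_mod_int) \<Rightarrow> bool" where
  "pure_quadratic_form D q \<longleftrightarrow> generalized_quadratic_form D q \<and>
    (\<forall>n::int. \<forall>x\<in>carrier D. q (x [^]\<^bsub>D\<^esub> n) = int_mult (n\<^sup>2) (q x))"

definition gauss_sum_formula ::
    "('a, 'm) monoid_scheme \<Rightarrow> ('a \<Rightarrow> rat_mod_int) \<Rightarrow> int \<Rightarrow> bool" where
  "gauss_sum_formula D q C \<longleftrightarrow>
    1 / complex_of_real (sqrt (real (card (carrier D)))) * (\<Sum>x\<in>carrier D. exp_2pi_i (q x)) =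
    exp (2 * complex_of_real pi * \<i> * of_int C / 8)"

text \<open>A finitely generated free abelian group is realised, together with its rationalisation, inside
  the infinite-dimensional rational vector space \<open>nat \<Rightarrow> rat\<close>: it is the group \<open>\<Lambda>\<close> of integral
  combinations of a finite rationally independent set, and then \<open>\<Lambda> \<otimes> \<rat>\<close> is the rational span
  of \<open>\<Lambda>\<close>. Every finitely generated free abelian group arises in this way up to isomorphism.\<close>

type_synonym rat_space = "nat \<Rightarrow> rat"

definition rat_scale :: "rat \<Rightarrow> rat_space \<Rightarrow> rat_space" where
  "rat_scale c v = (\<lambda>i. c * v i)"

interpretation rat_space: vector_space rat_scale
  by standard (simp_all add: rat_scale_def fun_eq_iff algebra_simps)

definition free_fg_group :: "rat_space set \<Rightarrow> bool" where
  "free_fg_group \<Lambda> \<longleftrightarrow>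
    (\<exists>S. finite S \<and> rat_space.independent S \<and>
      \<Lambda> = {\<Sum>s\<in>S. rat_scale (of_int (c s)) s | c :: rat_space \<Rightarrow> int. True})"

text \<open>The form \<open>B\<close> on \<open>\<Lambda>\<close> is given through its unique rational bilinear extension to
  \<open>\<Lambda> \<otimes> \<rat>\<close>; its values outside of the rational span of \<open>\<Lambda>\<close> are irrelevant.\<close>

definition even_lattice :: "rat_space set \<Rightarrow> (rat_space \<Rightarrow> rat_space \<Rightarrow> rat) \<Rightarrow> bool" where
  "even_lattice \<Lambda> B \<longleftrightarrow>
    free_fg_group \<Lambda> \<and>
    (\<forall>x\<in>rat_space.span \<Lambda>. \<forall>y\<in>rat_space.span \<Lambda>. B x y = B y x) \<and>
    (\<forall>x\<in>rat_space.span \<Lambda>. \<forall>y\<in>rat_space.span \<Lambda>. \<forall>z\<in>rat_space.span \<Lambda>.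
      B (x + y) z = B x z + B y z) \<and>
    (\<forall>c. \<forall>x\<in>rat_space.span \<Lambda>. \<forall>y\<in>rat_space.span \<Lambda>. B (rat_scale c x) y = c * B x y) \<and>
    (\<forall>x\<in>\<Lambda>. \<forall>y\<in>\<Lambda>. B x y \<in> \<int>) \<and>
    (\<forall>x\<in>\<Lambda>. (\<forall>y\<in>\<Lambda>. B x y = 0) \<longrightarrow> x = 0) \<and>
    (\<forall>x\<in>\<Lambda>. \<exists>k::int. B x x = of_int (2 * k))"

definition dual_lattice ::
    "rat_space set \<Rightarrow> (rat_space \<Rightarrow> rat_space \<Rightarrow> rat) \<Rightarrow> rat_space monoid" where
  "dual_lattice \<Lambda> B =
    \<lparr>carrier = {v \<in> rat_space.span \<Lambda>. \<forall>x\<in>\<Lambda>. B v x \<in> \<int>}, mult = (+), one = 0\<rparr>"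

definition discriminant_group ::
    "rat_space set \<Rightarrow> (rat_space \<Rightarrow> rat_space \<Rightarrow> rat) \<Rightarrow> rat_space set monoid" where
  "discriminant_group \<Lambda> B = dual_lattice \<Lambda> B Mod \<Lambda>"

text \<open>By Sylvester's law of inertia the difference below does not depend on the orthogonal
  basis \<open>E\<close> of \<open>\<Lambda> \<otimes> \<rat>\<close>, and such a basis always exists.\<close>

definition has_signature ::
    "rat_space set \<Rightarrow> (rat_space \<Rightarrow> rat_space \<Rightarrow> rat) \<Rightarrow> int \<Rightarrow> bool" where
  "has_signature \<Lambda> B s \<longleftrightarrow>
    (\<exists>E. finite E \<and> rat_space.independent E \<and> rat_space.span E = rat_space.span \<Lambda> \<and>
      (\<forall>d\<in>E. \<forall>e\<in>E. d \<noteq> e \<longrightarrow> B d e = 0) \<and>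
      s = int (card {e \<in> E. B e e > 0}) - int (card {e \<in> E. B e e < 0}))"

text \<open>The coset of \<open>v\<close> modulo \<open>\<Lambda>\<close> is \<open>\<Lambda> #> v\<close>. The last condition says that \<open>\<phi>\<close> carries the form
  induced by \<open>B\<close> on the discriminant group to the bilinear form of \<open>q\<close>.\<close>

definition lifts_to_even_lattice ::
    "('a, 'm) monoid_scheme \<Rightarrow> ('a \<Rightarrow> rat_mod_int) \<Rightarrow> int \<Rightarrow> bool" where
  "lifts_to_even_lattice D q C \<longleftrightarrow>
    (\<exists>\<Lambda> B s \<phi>. even_lattice \<Lambda> B \<and> has_signature \<Lambda> B s \<and> s mod 8 = C mod 8 \<and>
      \<phi> \<in> iso (discriminant_group \<Lambda> B) D \<and>
      (\<forall>v\<in>carrier (dual_lattice \<Lambda> B). \<forall>w\<in>carrier (dual_lattice \<Lambda> B).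
        assoc_form D q (\<phi> (\<Lambda> #>\<^bsub>dual_lattice \<Lambda> B\<^esub> v)) (\<phi> (\<Lambda> #>\<^bsub>dual_lattice \<Lambda> B\<^esub> w)) =
        rat_class (B v w)))"

end

theory Submission
  imports "HOL-Computational_Algebra.Primes" Defs
begin

text \<open>
  Both parts use \<open>D = \<int>/4\<close> with \<open>q(x) = (x\<^sup>2 + 2 x) / 8\<close>, whose bilinear form is \<open>x y / 4\<close>. The
  linear term \<open>x / 4\<close> destroys purity and turns the Gauss sum into \<open>C = 0\<close>, whereas the lattices with
  this discriminant form all have odd signature.

  Indeed, let \<open>\<Lambda>\<close> be an even lattice of rank \<open>n\<close>, put \<open>Q(x) = B(x, x) / 2\<close> and let \<open>\<gamma>\<close> be the sum of
  \<open>(-1)^Q(x)\<close> over \<open>\<Lambda>/2\<Lambda>\<close>. Then \<open>\<gamma>\<^sup>2\<close> is \<open>2^n\<close> times the sum of \<open>(-1)^Q(r)\<close> over the radical of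
  \<open>B mod 2\<close>. Halving identifies this radical with the 2-torsion \<open>{0, v}\<close> of \<open>\<Lambda>\<^sup>*/\<Lambda>\<close>, and
  \<open>Q(2 v) = 2 B(v, v)\<close> is even because \<open>v\<close> corresponds to \<open>2 \<in> \<int>/4\<close>. So the integer \<open>\<gamma>\<close> has square
  \<open>2^(n + 1)\<close>, and \<open>n\<close> is odd; the signature has the parity of \<open>n\<close>.
\<close>

section \<open>Gauss sums of even symmetric integer matrices modulo 2\<close>

definition parity_sign :: "int \<Rightarrow> int" where
  "parity_sign k = (if even k then 1 else -1)"

lemma parity_sign_add: "parity_sign (a + b) = parity_sign a * parity_sign b"
  by (simp add: parity_sign_def)

lemma parity_sign_cong: "even (a - b) \<Longrightarrow> parity_sign a = parity_sign b"
  by (auto simp: parity_sign_def)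

lemma parity_sign_square: "parity_sign a * parity_sign a = 1"
  by (simp add: parity_sign_def)

text \<open>The last term removes the overlap, which both full sums contain and
  \<open>sym_diff\<close> omits. It vanishes modulo 2, so there summation is additive for the
  addition of subsets.\<close>

lemma sum_sym_diff:
  fixes f :: "'a \<Rightarrow> 'b :: comm_ring_1"
  assumes "finite T" "finite U"
  shows "sum f (sym_diff T U) = sum f T + sum f U - 2 * sum f (T \<inter> U)"
proof -
  have "sum f (sym_diff T U) = sum f (T - U) + sum f (U - T)"
    using assms by (intro sum.union_disjoint) auto
  moreover have "sum f T = sum f (T - U) + sum f (T \<inter> U)"
    using assms by (metis add.commute sum.Int_Diff)
  moreover have "sum f U = sum f (U - T) + sum f (T \<inter> U)"
    using assms by (metis add.commute sum.Int_Diff Int_commute)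
  ultimately show ?thesis by (simp add: algebra_simps)
qed

text \<open>Off-diagonal terms occur in equal pairs, and the diagonal is even by assumption.\<close>

lemma even_double_sum_symmetric:
  fixes g :: "'a \<Rightarrow> 'a \<Rightarrow> int"
  assumes "finite T" and "\<And>s t. s \<in> T \<Longrightarrow> t \<in> T \<Longrightarrow> g s t = g t s"
    and "\<And>s. s \<in> T \<Longrightarrow> even (g s s)"
  shows "even (\<Sum>s\<in>T. \<Sum>t\<in>T. g s t)"
  using assms
proof (induction T rule: finite_induct)
  case (insert a T)
  have "(\<Sum>s\<in>T. g s a) = (\<Sum>s\<in>T. g a s)"
    using insert by (intro sum.cong) auto
  with insert show ?case
    by (simp add: sum.distrib)
qed simp

text \<open>Both sides have the same 2-adic valuation, and that of a square is even.\<close>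

lemma even_exponent_if_square:
  fixes a :: int
  assumes "a ^ 2 = 2 ^ n"
  shows "even n"
proof -
  have "a \<noteq> 0" using assms by auto
  then have "multiplicity 2 (a ^ 2) = 2 * multiplicity 2 a"
    by (simp add: prime_elem_multiplicity_power_distrib)
  moreover have "multiplicity 2 ((2::int) ^ n) = n"
    by (simp add: multiplicity_same_power)
  ultimately show ?thesis using assms by simp
qed

text \<open>A subset of \<open>S\<close> stands for a class of \<open>\<Lambda>/2\<Lambda>\<close>, where \<open>S\<close> is a basis of \<open>\<Lambda>\<close> with Gram matrix \<open>g\<close>;
  symmetric difference is then the addition.\<close>

lemma odd_card_if_mod_2_radical_order_2:
  fixes g :: "'a \<Rightarrow> 'a \<Rightarrow> int"
  assumes fin: "finite S"
    and sym: "\<And>s t. s \<in> S \<Longrightarrow> t \<in> S \<Longrightarrow> g s t = g t s"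
    and ev: "\<And>s. s \<in> S \<Longrightarrow> even (g s s)"
    and rad: "{U \<in> Pow S. \<forall>s\<in>S. even (\<Sum>t\<in>U. g s t)} = {{}, R}"
    and "R \<noteq> {}" and R4: "4 dvd (\<Sum>s\<in>R. \<Sum>t\<in>R. g s t)"
  shows "odd (card S)"
proof -
  \<comment> \<open>\<open>b\<close> evaluates the form on indicator vectors of subsets;
    \<open>Q\<close> is half its diagonal, and \<open>bQ\<close> shows that this division is
    exact.\<close>
  define b where "b = (\<lambda>T U. \<Sum>s\<in>T. \<Sum>t\<in>U. g s t)"
  define Q where "Q = (\<lambda>T. b T T div 2)"
  have finP: "finite T" if "T \<in> Pow S" for T
    using that fin finite_subset by auto
  have bQ: "b T T = 2 * Q T" if "T \<in> Pow S" for T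
    using even_double_sum_symmetric[of T g] that sym ev finP[OF that]
    unfolding Q_def b_def by (metis PowD dvd_mult_div_cancel subsetD)
  have b_sym: "b T U = b U T" if "T \<in> Pow S" "U \<in> Pow S" for T U
    unfolding b_def by (subst sum.swap, intro sum.cong refl) (use that sym in auto)
  \<comment> \<open>The indicator vector of \<open>sym_diff T U\<close> is the integer sum of those
    of \<open>T\<close> and \<open>U\<close> minus twice that of \<open>T \<inter> U\<close>; hence
    the correction term.\<close>
  have b_left: "b (sym_diff T U) V = b T V + b U V - 2 * b (T \<inter> U) V"
    if "T \<in> Pow S" "U \<in> Pow S" for T U V
    unfolding b_def using that finP by (intro sum_sym_diff) auto
  have b_right: "b V (sym_diff T U) = b V T + b V U - 2 * b V (T \<inter> U)"
    if "T \<in> Pow S" "U \<in> Pow S" for T U V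
    unfolding b_def using that finP
    by (simp add: sum_sym_diff sum.distrib sum_subtractf sum_distrib_left)
  \<comment> \<open>This is Q(T + U) = Q(T) + Q(U) + b(T, U) modulo 2. The corrections to the
    doubled identity are multiples of 4, so they stay even after halving; the sign of
    \<open>Q T\<close> then occurs squared and cancels.\<close>
  have shift: "parity_sign (Q T) * parity_sign (Q (sym_diff T U)) =
      parity_sign (Q U) * parity_sign (b T U)"
    if T: "T \<in> Pow S" and U: "U \<in> Pow S" for T U
  proof -
    let ?W = "T \<inter> U"
    have W: "?W \<in> Pow S" and TU: "sym_diff T U \<in> Pow S" using T U by auto
    have "2 * Q (sym_diff T U) = b (sym_diff T U) (sym_diff T U)"
      using bQ[OF TU] by simp
    also have "\<dots> = b T T + b U U + 2 * b T U - 4 * b T ?W - 4 * b U ?W + 4 * b ?W ?W"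
      unfolding b_left[OF T U] b_right[OF T U]
      using b_sym[OF U T] b_sym[OF W T] b_sym[OF W U] by simp
    finally have "Q (sym_diff T U) - (Q T + Q U + b T U) = 2 * (b ?W ?W - b T ?W - b U ?W)"
      using bQ[OF T] bQ[OF U] by simp
    then have "parity_sign (Q (sym_diff T U)) = parity_sign (Q T + Q U + b T U)"
      by (intro parity_sign_cong) simp
    then show ?thesis
      by (simp add: parity_sign_add parity_sign_square flip: mult.assoc)
  qed
  have translate: "(\<Sum>U\<in>Pow S. f (sym_diff T U)) = (\<Sum>U\<in>Pow S. f U)"
    if "T \<in> Pow S" for T and f :: "'a set \<Rightarrow> int"
    by (rule sum.reindex_bij_witness[of _ "sym_diff T" "sym_diff T"]) (use that in auto)
  \<comment> \<open>Orthogonality of characters: the summand is a character in \<open>T\<close>,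
    trivial when \<open>U\<close> lies in the radical. Otherwise some \<open>s\<close> pairs oddly
    with \<open>U\<close>, and toggling \<open>s\<close> in \<open>T\<close> flips every sign, so
    the sum equals its own negative.\<close>
  have character_sum: "(\<Sum>T\<in>Pow S. parity_sign (b T U)) = (if U \<in> {{}, R} then 2 ^ card S else 0)"
    if U: "U \<in> Pow S" for U
  proof (cases "\<forall>s\<in>S. even (\<Sum>t\<in>U. g s t)")
    case True
    then have "U \<in> {{}, R}" using rad U by blast
    moreover have "parity_sign (b T U) = 1" if "T \<in> Pow S" for T
      using True that dvd_sum[of T 2 "\<lambda>s. \<Sum>t\<in>U. g s t"] unfolding b_def parity_sign_def by auto
    ultimately show ?thesis by (simp add: card_Pow fin)
  next
    case False
    then obtain s where s: "s \<in> S" "odd (\<Sum>t\<in>U. g s t)" by blast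
    have "(\<Sum>T\<in>Pow S. parity_sign (b T U)) = (\<Sum>T\<in>Pow S. parity_sign (b (sym_diff {s} T) U))"
      using translate[of "{s}" "\<lambda>T. parity_sign (b T U)"] s by simp
    also have "\<dots> = (\<Sum>T\<in>Pow S. - parity_sign (b T U))"
    proof (rule sum.cong)
      fix T assume "T \<in> Pow S"
      then show "parity_sign (b (sym_diff {s} T) U) = - parity_sign (b T U)"
        using s b_left[of "{s}" T U] by (simp add: parity_sign_def b_def)
    qed simp
    finally have "(\<Sum>T\<in>Pow S. parity_sign (b T U)) = 0" by (simp add: sum_negf)
    moreover have "U \<notin> {{}, R}" using False rad by blast
    ultimately show ?thesis by simp
  qed
  have RS: "R \<in> Pow S" using rad by blast
  \<comment> \<open>The square becomes a double sum whose inner variable is translated by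
    \<open>T\<close>. After \<open>shift\<close>, \<open>T\<close> occurs only in the character, so
    summing over \<open>T\<close> first leaves just the radical.\<close>
  have "(\<Sum>T\<in>Pow S. parity_sign (Q T)) ^ 2 =
      (\<Sum>T\<in>Pow S. parity_sign (Q T) * (\<Sum>U\<in>Pow S. parity_sign (Q U)))"
    by (simp add: power2_eq_square sum_distrib_right)
  also have "\<dots> = (\<Sum>T\<in>Pow S. \<Sum>U\<in>Pow S. parity_sign (Q T) * parity_sign (Q (sym_diff T U)))"
    by (intro sum.cong refl) (simp add: translate[of _ "\<lambda>U. parity_sign (Q U)"] flip: sum_distrib_left)
  also have "\<dots> = (\<Sum>T\<in>Pow S. \<Sum>U\<in>Pow S. parity_sign (Q U) * parity_sign (b T U))"
    by (intro sum.cong refl shift)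
  also have "\<dots> = (\<Sum>U\<in>Pow S. parity_sign (Q U) * (\<Sum>T\<in>Pow S. parity_sign (b T U)))"
    by (subst sum.swap) (simp add: sum_distrib_left)
  also have "\<dots> = (\<Sum>U\<in>Pow S. if U \<in> {{}, R} then parity_sign (Q U) * 2 ^ card S else 0)"
    by (intro sum.cong refl) (simp add: character_sum)
  also have "\<dots> = (\<Sum>U\<in>{{}, R}. parity_sign (Q U) * 2 ^ card S)"
    using fin RS by (intro sum.mono_neutral_cong_right) auto
  \<comment> \<open>Both remaining signs are 1: \<open>Q {}\<close> is 0, and \<open>Q R\<close> is
    even because 4 divides \<open>b R R\<close>.\<close>
  also have "\<dots> = 2 ^ (card S + 1)"
    using \<open>R \<noteq> {}\<close> R4 by (auto simp: Q_def b_def parity_sign_def)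
  finally show ?thesis using even_exponent_if_square by fastforce
qed

section \<open>The quadratic form on the cyclic group of order 4\<close>

lemma rat_class_eq_iff: "rat_class r = rat_class s \<longleftrightarrow> r - s \<in> \<int>"
  by transfer simp

lemma rat_class_eq_0_iff: "rat_class r = 0 \<longleftrightarrow> r \<in> \<int>"
  by transfer simp

lemma rat_class_add: "rat_class (r + s) = rat_class r + rat_class s"
  by transfer simp

lemma rat_class_diff: "rat_class (r - s) = rat_class r - rat_class s"
  by transfer simp

definition Z4 :: "nat monoid" where
  "Z4 = \<lparr>carrier = {..<4}, mult = (\<lambda>x y. (x + y) mod 4), one = 0\<rparr>"

definition q4 :: "nat \<Rightarrow> rat_mod_int" where
  "q4 x = rat_class (of_nat (x\<^sup>2 + 2 * x) / 8)"

lemma Z4_simps [simp]: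
  "carrier Z4 = {..<4}" "x \<otimes>\<^bsub>Z4\<^esub> y = (x + y) mod 4" "\<one>\<^bsub>Z4\<^esub> = 0"
  by (simp_all add: Z4_def)

lemma comm_group_Z4: "comm_group Z4"
proof (rule comm_groupI)
  fix x assume "x \<in> carrier Z4"
  then show "\<exists>y\<in>carrier Z4. y \<otimes>\<^bsub>Z4\<^esub> x = \<one>\<^bsub>Z4\<^esub>"
    by (intro bexI[of _ "(4 - x) mod 4"]) (auto simp: mod_simps)
qed (auto simp: mod_simps add_ac)

lemma rat_class_mod:
  fixes m :: nat
  shows "rat_class (of_nat (m mod k) * of_nat z / of_nat k) = rat_class (of_nat m * of_nat z / of_nat k)"
\<comment> \<open>For \<open>k = 0\<close> the sides coincide, because \<open>m mod 0\<close> is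
  \<open>m\<close>.\<close>
proof (cases "k = 0")
  case False
  have "(of_nat m :: rat) = of_nat (m mod k) + of_nat k * of_nat (m div k)"
    by (metis mod_mult_div_eq of_nat_add of_nat_mult)
  then have "of_nat (m mod k) * of_nat z / of_nat k - of_nat m * of_nat z / of_nat k =
      - (of_nat (m div k) * of_nat z :: rat)"
    using False by (simp add: field_simps)
  then show ?thesis by (simp add: rat_class_eq_iff)
qed (simp add: rat_class_eq_iff)

text \<open>Replacing x by x + 4k adds k(x + 2k + 1), an integer, to (x^2 + 2x)/8. Reduction modulo
  4 in the group law can thus be ignored when \<open>q4\<close> is evaluated.\<close>

lemma q4_mod: "q4 (x mod 4) = q4 x"
proof -
  have "(of_nat x :: rat) = of_nat (x mod 4) + 4 * of_nat (x div 4)"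
    by (metis mod_mult_div_eq of_nat_add of_nat_mult of_nat_numeral)
  then have "of_nat ((x mod 4)\<^sup>2 + 2 * (x mod 4)) / 8 - of_nat (x\<^sup>2 + 2 * x) / 8 =
     - (of_nat (x div 4) * (of_nat (x mod 4) + 2 * of_nat (x div 4) + 1) :: rat)"
    by (simp add: field_simps power2_eq_square)
  then show ?thesis unfolding q4_def rat_class_eq_iff by simp
qed

lemma assoc_form_q4: "assoc_form Z4 q4 x y = rat_class (of_nat x * of_nat y / 4)"
proof -
  have "assoc_form Z4 q4 x y = q4 (x + y) - q4 x - q4 y + q4 0"
    by (simp add: assoc_form_def q4_mod)
  also have "\<dots> = rat_class (of_nat x * of_nat y / 4)"
    unfolding q4_def rat_class_add[symmetric] rat_class_diff[symmetric]
    by (rule arg_cong[of _ _ rat_class]) (simp add: field_simps power2_eq_square)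
  finally show ?thesis .
qed

lemma generalized_quadratic_form_q4: "generalized_quadratic_form Z4 q4"
  unfolding generalized_quadratic_form_def nondegenerate_symmetric_bilinear_def
proof (intro conjI ballI impI)
  fix x y z :: nat
  show "assoc_form Z4 q4 x y = assoc_form Z4 q4 y x"
    by (simp add: assoc_form_q4 mult.commute)
  show "assoc_form Z4 q4 (x \<otimes>\<^bsub>Z4\<^esub> y) z = assoc_form Z4 q4 x z + assoc_form Z4 q4 y z"
    using rat_class_mod[of "x + y" 4 z]
    by (simp add: assoc_form_q4 rat_class_add[symmetric] field_simps)
next
  fix x assume x: "x \<in> carrier Z4" and "\<forall>y\<in>carrier Z4. assoc_form Z4 q4 x y = 0"
  \<comment> \<open>Pairing with the generator 1 suffices, since \<open>x < 4\<close>.\<close>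
  then have "(of_nat x / 4 :: rat) \<in> \<int>"
    by (auto simp: assoc_form_q4 rat_class_eq_0_iff dest!: bspec[of _ _ 1])
  then obtain k where "(of_nat x / 4 :: rat) = of_int k" by (elim Ints_cases)
  then have "(of_int (int x) :: rat) = of_int (4 * k)" by simp
  then have "int x = 4 * k" by (simp only: of_int_eq_iff)
  then show "x = \<one>\<^bsub>Z4\<^esub>" using x by simp presburger
qed

text \<open>Doubling the generator is the counterexample: q(2) = 1 is 0 modulo 1, while 4 q(1) = 3/2
  is not.\<close>

lemma not_pure_q4: "\<not> pure_quadratic_form Z4 q4"
proof
  assume "pure_quadratic_form Z4 q4"
  then have "q4 (1 [^]\<^bsub>Z4\<^esub> (2::int)) = int_mult (2\<^sup>2) (q4 1)"
    unfolding pure_quadratic_form_def by (auto dest!: spec[of _ 2] bspec[of _ _ 1])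
  moreover have "1 [^]\<^bsub>Z4\<^esub> (2::int) = 2"
  proof -
    interpret comm_group Z4 by (rule comm_group_Z4)
    have "1 [^]\<^bsub>Z4\<^esub> (2::int) = 1 [^]\<^bsub>Z4\<^esub> (2::nat)"
      by (metis int_pow_int of_nat_numeral)
    also have "\<dots> = 2" by (simp add: numeral_2_eq_2)
    finally show ?thesis .
  qed
  moreover have "int_mult (2\<^sup>2) (q4 1) = rat_class (3 / 2)"
    unfolding q4_def by transfer simp
  ultimately have "(1 - 3 / 2 :: rat) \<in> \<int>"
    by (simp add: q4_def rat_class_eq_iff)
  then obtain k where "(1 - 3 / 2 :: rat) = of_int k" by (elim Ints_cases)
  then have "(of_int (2 * k) :: rat) = of_int (- 1)" by simp
  then show False by (simp only: of_int_eq_iff) presburger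
qed

lemma exp_2pi_i_rat_class: "exp_2pi_i (rat_class r) = cis (2 * pi * of_rat r)"
  by transfer (simp add: cis_conv_exp mult_ac)

text \<open>The values of the form are 0, 3/8, 1 and 15/8. The second and fourth differ by 3/2, so
  their exponentials cancel; the other two add up to 2, the square root of the order.\<close>

lemma gauss_sum_q4: "gauss_sum_formula Z4 q4 0"
proof -
  have "cis (pi * 15 / 4) = cis (pi * 3 / 4 + pi + 2 * pi)"
    by (rule arg_cong[of _ _ cis]) simp
  also have "\<dots> = - cis (pi * 3 / 4)"
    by (simp only: cis_mult[symmetric]) simp
  finally have "cis (pi * 15 / 4) = - cis (pi * 3 / 4)" .
  then show ?thesis
    by (simp add: gauss_sum_formula_def q4_def exp_2pi_i_rat_class numeral_eq_Suc lessThan_Suc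
        of_rat_divide)
qed


section \<open>Even lattices in coordinates: rank, signature and 2-torsion\<close>

lemma of_int_half_in_Ints_iff: "(of_int k / 2 :: rat) \<in> \<int> \<longleftrightarrow> even k"
proof
  assume "(of_int k / 2 :: rat) \<in> \<int>"
  then obtain m where "(of_int k / 2 :: rat) = of_int m" by (elim Ints_cases)
  then have "(of_int k :: rat) = of_int (2 * m)" by simp
  then show "even k" by (simp only: of_int_eq_iff) simp
qed auto

locale even_lattice_basis =
  fixes \<Lambda> :: "rat_space set" and B :: "rat_space \<Rightarrow> rat_space \<Rightarrow> rat" and S :: "rat_space set"
  assumes even_lattice: "even_lattice \<Lambda> B"
    and finite_basis: "finite S"
    and independent_basis: "rat_space.independent S"
    and lattice_eq: "\<Lambda> = {\<Sum>s\<in>S. rat_scale (of_int (c s)) s | c :: rat_space \<Rightarrow> int. True}"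
begin

text \<open>Rational coordinates are allowed so that the same map also describes dual vectors and
  halves of lattice vectors.\<close>

definition comb :: "(rat_space \<Rightarrow> rat) \<Rightarrow> rat_space" where
  "comb a = (\<Sum>s\<in>S. rat_scale (a s) s)"

lemma comb_add: "comb (\<lambda>s. a s + b s) = comb a + comb b"
  by (simp add: comb_def rat_space.scale_left_distrib sum.distrib)

lemma comb_diff: "comb (\<lambda>s. a s - b s) = comb a - comb b"
  by (simp add: comb_def rat_space.scale_left_diff_distrib sum_subtractf)

lemma comb_scale: "comb (\<lambda>s. c * a s) = rat_scale c (comb a)"
  by (simp add: comb_def rat_space.scale_sum_right)

lemma comb_eq_0_iff: "comb a = 0 \<longleftrightarrow> (\<forall>s\<in>S. a s = 0)"
  using rat_space.independentD[OF independent_basis finite_basis subset_refl, of a]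
  by (auto simp: comb_def)

text \<open>By independence the coordinates on \<open>S\<close> are unique, so they agree with those
  of any integral representation.\<close>

lemma comb_in_lattice_iff: "comb a \<in> \<Lambda> \<longleftrightarrow> (\<forall>s\<in>S. a s \<in> \<int>)"
proof
  assume "comb a \<in> \<Lambda>"
  then obtain c :: "rat_space \<Rightarrow> int" where "comb a = comb (\<lambda>s. of_int (c s))"
    unfolding lattice_eq comb_def by blast
  then have "comb (\<lambda>s. a s - of_int (c s)) = 0" by (simp add: comb_diff)
  then show "\<forall>s\<in>S. a s \<in> \<int>" by (simp add: comb_eq_0_iff)
next
  assume "\<forall>s\<in>S. a s \<in> \<int>"
  then have "comb a = comb (\<lambda>s. of_int \<lfloor>a s\<rfloor>)"
    unfolding comb_def by (intro sum.cong refl) (metis Ints_cases floor_of_int)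
  then show "comb a \<in> \<Lambda>" unfolding lattice_eq comb_def
    by (intro CollectI exI[of _ "\<lambda>s. \<lfloor>a s\<rfloor>"]) simp
qed

lemma lattice_diff: "x \<in> \<Lambda> \<Longrightarrow> y \<in> \<Lambda> \<Longrightarrow> x - y \<in> \<Lambda>"
proof -
  assume xy: "x \<in> \<Lambda>" "y \<in> \<Lambda>"
  then obtain c d where "x = comb c" "y = comb d"
    unfolding lattice_eq comb_def by auto
  with xy show "x - y \<in> \<Lambda>" by (simp add: comb_in_lattice_iff flip: comb_diff)
qed

lemma comb_delta: "s \<in> S \<Longrightarrow> comb (\<lambda>t. if t = s then 1 else 0) = s"
  using finite_basis by (simp add: comb_def if_distrib[of "\<lambda>c. rat_scale c _"] cong: if_cong)

lemma basis_subset: "S \<subseteq> \<Lambda>"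
proof
  fix s assume "s \<in> S"
  then show "s \<in> \<Lambda>"
    using comb_in_lattice_iff[of "\<lambda>t. if t = s then 1 else 0"] comb_delta by simp
qed

lemma lattice_subset_span: "\<Lambda> \<subseteq> rat_space.span S"
  unfolding lattice_eq
  by (auto intro!: rat_space.span_sum rat_space.span_scale intro: rat_space.span_base)

lemma span_lattice: "rat_space.span \<Lambda> = rat_space.span S"
  using basis_subset lattice_subset_span
  by (metis rat_space.span_minimal rat_space.span_mono rat_space.subspace_span subset_antisym)

lemma span_eq_range_comb: "rat_space.span \<Lambda> = range comb"
  unfolding span_lattice rat_space.span_finite[OF finite_basis] comb_def ..

lemma B_sym: "x \<in> rat_space.span \<Lambda> \<Longrightarrow> y \<in> rat_space.span \<Lambda> \<Longrightarrow> B x y = B y x"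
  using even_lattice unfolding even_lattice_def by blast

lemma B_add_left:
  "x \<in> rat_space.span \<Lambda> \<Longrightarrow> y \<in> rat_space.span \<Lambda> \<Longrightarrow> z \<in> rat_space.span \<Lambda> \<Longrightarrow>
    B (x + y) z = B x z + B y z"
  using even_lattice unfolding even_lattice_def by blast

lemma B_scale_left:
  "x \<in> rat_space.span \<Lambda> \<Longrightarrow> y \<in> rat_space.span \<Lambda> \<Longrightarrow> B (rat_scale c x) y = c * B x y"
  using even_lattice unfolding even_lattice_def by blast

lemma B_zero_left: "y \<in> rat_space.span \<Lambda> \<Longrightarrow> B 0 y = 0"
  using B_scale_left[of 0 y 0] rat_space.span_zero by simp

lemma B_sum_left:
  assumes "finite T" "T \<subseteq> rat_space.span \<Lambda>" "y \<in> rat_space.span \<Lambda>"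
  shows "B (\<Sum>s\<in>T. rat_scale (a s) s) y = (\<Sum>s\<in>T. a s * B s y)"
  using assms
proof (induction T rule: finite_induct)
  case (insert s T)
  moreover have "(\<Sum>s\<in>T. rat_scale (a s) s) \<in> rat_space.span \<Lambda>"
    using insert.prems by (intro rat_space.span_sum rat_space.span_scale) auto
  moreover have "rat_scale (a s) s \<in> rat_space.span \<Lambda>"
    using insert.prems by (intro rat_space.span_scale) auto
  ultimately show ?case
    using B_add_left[of "rat_scale (a s) s" "\<Sum>s\<in>T. rat_scale (a s) s" y]
    by (subst (1 2) sum.insert) (auto simp: B_scale_left)
qed (simp add: B_zero_left)

lemma basis_subset_span: "S \<subseteq> rat_space.span \<Lambda>"
  by (simp add: span_lattice rat_space.span_superset)

lemma B_comb_left: "y \<in> rat_space.span \<Lambda> \<Longrightarrow> B (comb a) y = (\<Sum>s\<in>S. a s * B s y)"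
  unfolding comb_def using finite_basis basis_subset_span by (rule B_sum_left)

lemma comb_in_span: "comb a \<in> rat_space.span \<Lambda>"
  by (simp add: span_eq_range_comb)

lemma B_comb_right:
  assumes "y \<in> rat_space.span \<Lambda>"
  shows "B y (comb a) = (\<Sum>s\<in>S. a s * B y s)"
proof -
  have "B y (comb a) = (\<Sum>s\<in>S. a s * B s y)"
    using assms by (simp add: B_sym[of y] B_comb_left comb_in_span)
  also have "\<dots> = (\<Sum>s\<in>S. a s * B y s)"
    using assms basis_subset_span by (intro sum.cong refl) (auto simp: B_sym[of y])
  finally show ?thesis .
qed

lemma B_integral: "x \<in> \<Lambda> \<Longrightarrow> y \<in> \<Lambda> \<Longrightarrow> B x y \<in> \<int>"
  using even_lattice unfolding even_lattice_def by blast

lemma lattice_subset_rat_span: "\<Lambda> \<subseteq> rat_space.span \<Lambda>"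
  by (rule rat_space.span_superset)

lemma lattice_subset_dual: "\<Lambda> \<subseteq> carrier (dual_lattice \<Lambda> B)"
  using lattice_subset_rat_span B_integral by (auto simp: dual_lattice_def)

lemma B_dual_lattice: "v \<in> carrier (dual_lattice \<Lambda> B) \<Longrightarrow> x \<in> \<Lambda> \<Longrightarrow> B v x \<in> \<int>"
  by (simp add: dual_lattice_def)

lemma dual_iff:
  "v \<in> carrier (dual_lattice \<Lambda> B) \<longleftrightarrow> v \<in> rat_space.span \<Lambda> \<and> (\<forall>s\<in>S. B v s \<in> \<int>)"
proof
  assume "v \<in> carrier (dual_lattice \<Lambda> B)"
  then show "v \<in> rat_space.span \<Lambda> \<and> (\<forall>s\<in>S. B v s \<in> \<int>)"
    using basis_subset by (auto simp: dual_lattice_def)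
next
  assume v: "v \<in> rat_space.span \<Lambda> \<and> (\<forall>s\<in>S. B v s \<in> \<int>)"
  have "B v x \<in> \<int>" if x: "x \<in> \<Lambda>" for x
  proof -
    obtain a where a: "x = comb a"
      using x lattice_subset_rat_span span_eq_range_comb by blast
    with x have "\<forall>s\<in>S. a s \<in> \<int>" by (simp add: comb_in_lattice_iff)
    then show ?thesis using v unfolding a
      by (simp add: B_comb_right Ints_sum Ints_mult)
  qed
  then show "v \<in> carrier (dual_lattice \<Lambda> B)"
    using v by (simp add: dual_lattice_def)
qed

text \<open>The product of all denominators serves as \<open>N\<close>. Scaling by it moves a vector
  of the rational span into the lattice.\<close>

lemma common_denominator:
  obtains N :: int where "N \<noteq> 0" "\<And>s. s \<in> S \<Longrightarrow> of_int N * a s \<in> (\<int> :: rat set)"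
proof -
  define d where "d = (\<lambda>s. snd (quotient_of (a s)))"
  have d: "d s > 0" "of_int (d s) * a s \<in> \<int>" for s
  proof -
    obtain p where "quotient_of (a s) = (p, d s)" by (simp add: d_def prod_eq_iff)
    then show "d s > 0" "of_int (d s) * a s \<in> \<int>"
      using quotient_of_div[of "a s" p "d s"] quotient_of_denom_pos[of "a s" p "d s"] by auto
  qed
  show thesis
  proof
    show "(\<Prod>s\<in>S. d s) \<noteq> 0" using d(1) finite_basis by (simp add: less_imp_neq[symmetric])
    fix s assume "s \<in> S"
    then have "of_int (\<Prod>s\<in>S. d s) * a s = of_int (\<Prod>s\<in>S - {s}. d s) * (of_int (d s) * a s)"
      using finite_basis by (simp only: prod.remove[of S s] of_int_mult mult_ac)
    then show "of_int (\<Prod>s\<in>S. d s) * a s \<in> \<int>"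
      using d(2) by (metis Ints_mult Ints_of_int)
  qed
qed

text \<open>\<open>even_lattice\<close> states nondegeneracy on \<open>\<Lambda>\<close> only; a
  nonzero multiple of \<open>x\<close> lies there.\<close>

lemma nondegenerate_on_span:
  assumes x: "x \<in> rat_space.span \<Lambda>" and orth: "\<And>y. y \<in> rat_space.span \<Lambda> \<Longrightarrow> B x y = 0"
  shows "x = 0"
proof -
  obtain a where a: "x = comb a" using x span_eq_range_comb by blast
  obtain N where N: "N \<noteq> 0" "\<And>s. s \<in> S \<Longrightarrow> of_int N * a s \<in> \<int>"
    using common_denominator[of a] by blast
  have "rat_scale (of_int N) x \<in> \<Lambda>"
    unfolding a comb_scale[symmetric] by (simp add: comb_in_lattice_iff N)
  moreover have "\<forall>y\<in>\<Lambda>. B (rat_scale (of_int N) x) y = 0"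
    using x orth lattice_subset_rat_span by (auto simp: B_scale_left)
  ultimately have "rat_scale (of_int N) x = 0"
    using even_lattice unfolding even_lattice_def by blast
  with N show ?thesis by simp
qed

text \<open>An isotropic member of the orthogonal basis \<open>E\<close> would be orthogonal to the
  whole span, hence zero. So \<open>E\<close> splits into positive and negative vectors, and the
  difference of their numbers has the parity of \<open>card E\<close>, which is the rank.\<close>

lemma signature_parity:
  assumes "has_signature \<Lambda> B s"
  shows "even s \<longleftrightarrow> even (card S)"
proof -
  obtain E where E: "finite E" "rat_space.independent E"
      and span: "rat_space.span E = rat_space.span \<Lambda>"
      and orth: "\<And>d e. d \<in> E \<Longrightarrow> e \<in> E \<Longrightarrow> d \<noteq> e \<Longrightarrow> B d e = 0"
      and s: "s = int (card {e \<in> E. B e e > 0}) - int (card {e \<in> E. B e e < 0})"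
    using assms unfolding has_signature_def by blast
  have sub: "E \<subseteq> rat_space.span \<Lambda>" using span rat_space.span_superset by blast
  have nonzero: "B e e \<noteq> 0" if e: "e \<in> E" for e
  proof
    assume "B e e = 0"
    have "B e y = 0" if y: "y \<in> rat_space.span \<Lambda>" for y
    proof -
      obtain u where u: "y = (\<Sum>d\<in>E. rat_scale (u d) d)"
        using y unfolding span[symmetric] rat_space.span_finite[OF E(1)] by blast
      have "B e y = (\<Sum>d\<in>E. u d * B d e)"
        using B_sym[of e y] e y sub B_sum_left[OF E(1) sub, of e u] unfolding u by auto
      also have "\<dots> = 0"
        using orth e \<open>B e e = 0\<close> by (intro sum.neutral) (metis mult_zero_right)
      finally show ?thesis .
    qed
    then have "e = 0" using nondegenerate_on_span sub e by blast
    with E e show False using rat_space.dependent_zero by blast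
  qed
  have "E = {e \<in> E. B e e > 0} \<union> {e \<in> E. B e e < 0}"
    using nonzero by (auto simp: neq_iff)
  then have "card E = card {e \<in> E. B e e > 0} + card {e \<in> E. B e e < 0}"
    using E(1) by (subst card_Un_disjoint[symmetric]) auto
  moreover have "card E = card S"
    using E independent_basis span span_lattice
    by (metis rat_space.dim_eq_card_independent rat_space.dim_span)
  ultimately show ?thesis using s by auto
qed

text \<open>Modulo \<open>\<Lambda>\<close>, each half of a lattice vector has exactly one
  representative \<open>half U\<close>. It lies in the dual lattice exactly when \<open>U\<close> is
  in the mod 2 radical of the Gram matrix, so the class of \<open>v\<close> supplies the set
  \<open>R\<close> needed for the Gauss sum argument.\<close>

lemma odd_rank_if_2_torsion_order_2:
  assumes v: "v \<in> carrier (dual_lattice \<Lambda> B)" "v \<notin> \<Lambda>" "v + v \<in> \<Lambda>" "B v v \<in> \<int>"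
    and tors: "\<And>w. w \<in> carrier (dual_lattice \<Lambda> B) \<Longrightarrow> w + w \<in> \<Lambda> \<Longrightarrow> w \<in> \<Lambda> \<or> w - v \<in> \<Lambda>"
  shows "odd (card S)"
proof -
  \<comment> \<open>The floor only changes the type: the form is integral on the basis.\<close>
  define g where "g = (\<lambda>s t. \<lfloor>B s t\<rfloor>)"
  have g: "of_int (g s t) = B s t" if "s \<in> S" "t \<in> S" for s t
    using B_integral[of s t] that basis_subset unfolding g_def
    by (metis Ints_cases floor_of_int subsetD)
  define half where "half = (\<lambda>U. comb (\<lambda>s. if s \<in> U then 1 / 2 else 0))"
  have half_span: "half U \<in> rat_space.span \<Lambda>" for U
    by (simp add: half_def comb_in_span)
  have half_not_int: "(1 / 2 :: rat) \<notin> \<int>" "(- 1 / 2 :: rat) \<notin> \<int>"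
    using of_int_half_in_Ints_iff[of 1] of_int_half_in_Ints_iff[of "- 1"] by simp_all
  \<comment> \<open>The coordinates of the difference are 0, 1/2 or -1/2, so integrality forces all
    of them to be 0.\<close>
  have half_diff_in: "half U - half V \<in> \<Lambda> \<longleftrightarrow> U = V" if "U \<subseteq> S" "V \<subseteq> S" for U V
    using that half_not_int unfolding half_def comb_diff[symmetric] comb_in_lattice_iff
    by (auto split: if_splits)
  have half_in: "half U \<in> \<Lambda> \<longleftrightarrow> U = {}" if "U \<subseteq> S" for U
    using that half_not_int unfolding half_def comb_in_lattice_iff by auto
  have half_double: "half U + half U \<in> \<Lambda>" for U
    unfolding half_def comb_add[symmetric] by (simp add: comb_in_lattice_iff)
  have B_half: "B (half U) s = of_int (\<Sum>t\<in>U. g s t) / 2" if "U \<subseteq> S" "s \<in> S" for U s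
  proof -
    have "B (half U) s = (\<Sum>t\<in>S. if t \<in> U then B t s / 2 else 0)"
      unfolding half_def using that basis_subset_span
      by (subst B_comb_left) (auto intro!: sum.cong)
    also have "\<dots> = (\<Sum>t\<in>U. B t s / 2)"
      using that finite_basis by (simp add: sum.If_cases Int_absorb1)
    also have "\<dots> = (\<Sum>t\<in>U. of_int (g s t) / 2)"
      using that basis_subset_span g B_sym
      by (intro sum.cong refl arg_cong[of _ _ "\<lambda>x. x / 2"]) (metis subsetD)
    finally show ?thesis by (simp add: sum_divide_distrib)
  qed
  have half_dual: "half U \<in> carrier (dual_lattice \<Lambda> B) \<longleftrightarrow> (\<forall>s\<in>S. even (\<Sum>t\<in>U. g s t))"
    if U: "U \<subseteq> S" for U
  proof -
    have "B (half U) s \<in> \<int> \<longleftrightarrow> even (\<Sum>t\<in>U. g s t)" if "s \<in> S" for s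
      by (simp only: B_half[OF U that] of_int_half_in_Ints_iff)
    then show ?thesis using half_span dual_iff by blast
  qed
  obtain a where a: "v = comb a"
    using v(1) span_eq_range_comb unfolding dual_iff by blast
  have a2: "2 * a s \<in> \<int>" if "s \<in> S" for s
    using v(3) that unfolding a comb_add[symmetric] comb_in_lattice_iff by (simp only: mult_2)
  \<comment> \<open>Since \<open>v + v\<close> is in the lattice, the coordinates of
    \<open>v\<close> at \<open>R\<close> are halves of odd integers; hence \<open>half R\<close>
    represents the class of \<open>v\<close>.\<close>
  define R where "R = {s \<in> S. a s \<notin> \<int>}"
  have RS: "R \<subseteq> S" by (auto simp: R_def)
  have vR: "half R - v \<in> \<Lambda>"
    unfolding half_def a comb_diff[symmetric] comb_in_lattice_iff
  proof
    fix s assume s: "s \<in> S"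
    show "(if s \<in> R then 1 / 2 else 0) - a s \<in> \<int>"
    proof (cases "a s \<in> \<int>")
      case False
      obtain k where k: "2 * a s = of_int k" using a2[OF s] by (elim Ints_cases)
      then have "a s = of_int k / 2" by simp
      with False have "odd k" using of_int_half_in_Ints_iff by simp
      have "1 / 2 - a s = of_int (1 - k) / 2" using k by (simp add: field_simps)
      also have "\<dots> \<in> \<int>" unfolding of_int_half_in_Ints_iff using \<open>odd k\<close> by simp
      finally show ?thesis using False s by (simp add: R_def)
    qed (simp add: R_def)
  qed
  have lattice_span: "half R - v \<in> rat_space.span \<Lambda>" using vR lattice_subset_rat_span by blast
  have v_span: "v \<in> rat_space.span \<Lambda>" by (simp add: a comb_in_span)
  have half_R: "half R = (half R - v) + v" by simp
  have R_dual: "half R \<in> carrier (dual_lattice \<Lambda> B)"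
  proof -
    have "B (half R) s \<in> \<int>" if s: "s \<in> S" for s
    proof -
      have "B (half R) s = B (half R - v) s + B v s"
        using B_add_left[OF lattice_span v_span, of s] s basis_subset_span by auto
      then show ?thesis
        using v(1) B_integral[OF vR] s basis_subset by (auto simp: dual_iff)
    qed
    then show ?thesis by (simp add: dual_iff half_span)
  qed
  have R_ne: "R \<noteq> {}"
  proof
    assume "R = {}"
    then have "v \<in> \<Lambda>" unfolding a comb_in_lattice_iff by (auto simp: R_def)
    with v show False by simp
  qed
  \<comment> \<open>With l = \<open>half R - v\<close> in the lattice, the value is B(half R, l) +
    B(v, l) + B(v, v). The first two terms are integral by duality, the third by assumption.\<close>
  have BR: "B (half R) (half R) \<in> \<int>"
  proof -
    let ?l = "half R - v"
    have "B (half R) (half R) = B ?l (half R) + B v (half R)"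
      using B_add_left[OF lattice_span v_span, of "half R"] by (simp add: half_span)
    also have "B ?l (half R) = B (half R) ?l"
      using lattice_span by (intro B_sym) (simp_all add: half_span)
    also have "B v (half R) = B ?l v + B v v"
      using B_add_left[OF lattice_span v_span v_span] B_sym[OF v_span, of "half R"]
      by (simp add: half_span)
    also have "B ?l v = B v ?l"
      using lattice_span v_span by (intro B_sym)
    finally show ?thesis
      using B_dual_lattice[OF R_dual vR] B_dual_lattice[OF v(1) vR] v(4) by (metis Ints_add)
  qed
  \<comment> \<open>Each argument contributes a factor 1/2, so integrality of the value becomes
    divisibility of the double sum by 4.\<close>
  have "B (half R) (half R) = of_int (\<Sum>s\<in>R. \<Sum>t\<in>R. g s t) / 4"
  proof -
    have "B (half R) (half R) = (\<Sum>s\<in>S. if s \<in> R then B (half R) s / 2 else 0)"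
      using B_comb_right[of "half R" "\<lambda>s. if s \<in> R then 1 / 2 else 0"]
      by (auto simp: half_def comb_in_span intro!: sum.cong)
    also have "\<dots> = (\<Sum>s\<in>R. B (half R) s / 2)"
      using RS finite_basis by (simp add: sum.If_cases Int_absorb1)
    also have "\<dots> = (\<Sum>s\<in>R. of_int (\<Sum>t\<in>R. g s t) / 4)"
      using RS by (intro sum.cong refl) (subst B_half, auto)
    finally show ?thesis by (simp add: sum_divide_distrib)
  qed
  with BR obtain m where "(of_int (\<Sum>s\<in>R. \<Sum>t\<in>R. g s t) / 4 :: rat) = of_int m"
    by (metis Ints_cases)
  then have "(of_int (\<Sum>s\<in>R. \<Sum>t\<in>R. g s t) :: rat) = of_int (4 * m)" by simp
  then have R4: "4 dvd (\<Sum>s\<in>R. \<Sum>t\<in>R. g s t)" by (simp only: of_int_eq_iff) simp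
  have "{U \<in> Pow S. \<forall>s\<in>S. even (\<Sum>t\<in>U. g s t)} = {{}, R}"
  proof (intro equalityI subsetI)
    fix U assume "U \<in> {U \<in> Pow S. \<forall>s\<in>S. even (\<Sum>t\<in>U. g s t)}"
    then have US: "U \<subseteq> S" and "half U \<in> carrier (dual_lattice \<Lambda> B)"
      using half_dual by auto
    then consider "half U \<in> \<Lambda>" | "half U - v \<in> \<Lambda>" using tors half_double by blast
    then show "U \<in> {{}, R}"
    proof cases
      case 1
      then show ?thesis using half_in US by simp
    next
      case 2
      have "half U - half R = (half U - v) - (half R - v)" by simp
      then have "half U - half R \<in> \<Lambda>" using 2 vR lattice_diff by metis
      then show ?thesis using half_diff_in US RS by simp
    qed
  next
    fix U assume "U \<in> {{}, R}"
    then show "U \<in> {U \<in> Pow S. \<forall>s\<in>S. even (\<Sum>t\<in>U. g s t)}"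
      using RS R_dual half_dual by auto
  qed
  moreover have "g s t = g t s" if "s \<in> S" "t \<in> S" for s t
    using that basis_subset_span B_sym unfolding g_def by (metis subsetD)
  moreover have "even (g s s)" if s: "s \<in> S" for s
  proof -
    obtain k where "B s s = of_int (2 * k)"
      using even_lattice s basis_subset unfolding even_lattice_def by blast
    then show ?thesis by (simp add: g_def del: of_int_mult)
  qed
  ultimately show ?thesis
    using odd_card_if_mod_2_radical_order_2[OF finite_basis _ _ _ R_ne R4] by blast
qed

lemma comm_group_dual: "comm_group (dual_lattice \<Lambda> B)"
proof (rule comm_groupI)
  fix v assume v: "v \<in> carrier (dual_lattice \<Lambda> B)"
  then have "- v \<in> carrier (dual_lattice \<Lambda> B)"
    using B_scale_left[of v _ "- 1"] basis_subset_span
    by (auto simp: dual_iff rat_space.span_neg subset_iff)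
  then show "\<exists>w\<in>carrier (dual_lattice \<Lambda> B). w \<otimes>\<^bsub>dual_lattice \<Lambda> B\<^esub> v = \<one>\<^bsub>dual_lattice \<Lambda> B\<^esub>"
    by (intro bexI[of _ "- v"]) (simp_all add: dual_lattice_def)
next
  fix v w assume "v \<in> carrier (dual_lattice \<Lambda> B)" "w \<in> carrier (dual_lattice \<Lambda> B)"
  then have "v + w \<in> carrier (dual_lattice \<Lambda> B)"
    using B_add_left[of v w] basis_subset_span
    by (simp add: dual_iff rat_space.span_add subset_iff)
  then show "v \<otimes>\<^bsub>dual_lattice \<Lambda> B\<^esub> w \<in> carrier (dual_lattice \<Lambda> B)"
    by (simp add: dual_lattice_def)
next
  have "0 \<in> carrier (dual_lattice \<Lambda> B)"
    using B_zero_left basis_subset_span by (simp add: dual_iff rat_space.span_zero subset_iff)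
  then show "\<one>\<^bsub>dual_lattice \<Lambda> B\<^esub> \<in> carrier (dual_lattice \<Lambda> B)"
    by (simp add: dual_lattice_def)
qed (simp_all add: dual_lattice_def add_ac)

lemma dual_diff:
  assumes "v \<in> carrier (dual_lattice \<Lambda> B)" "w \<in> carrier (dual_lattice \<Lambda> B)"
  shows "v - w \<in> carrier (dual_lattice \<Lambda> B)"
proof -
  have "B (v - w) s = B v s - B w s" if "s \<in> S" for s
    using B_add_left[of "v - w" w s] assms that basis_subset_span
    by (simp add: dual_iff rat_space.span_diff subset_iff)
  then show ?thesis using assms by (simp add: dual_iff rat_space.span_diff)
qed

lemma normal_lattice: "\<Lambda> \<lhd> dual_lattice \<Lambda> B"
proof -
  interpret comm_group "dual_lattice \<Lambda> B" by (rule comm_group_dual)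
  have 0: "0 \<in> \<Lambda>" using comb_in_lattice_iff[of "\<lambda>_. 0"] comb_eq_0_iff[of "\<lambda>_. 0"] by simp
  show ?thesis
  proof (rule subgroup_imp_normal, rule subgroupI)
    fix x assume x: "x \<in> \<Lambda>"
    have m: "0 - x \<in> \<Lambda>" by (rule lattice_diff[OF 0 x])
    then have "inv\<^bsub>dual_lattice \<Lambda> B\<^esub> x = 0 - x"
      using x lattice_subset_dual by (intro inv_equality) (auto simp: dual_lattice_def)
    with m show "inv\<^bsub>dual_lattice \<Lambda> B\<^esub> x \<in> \<Lambda>" by simp
  next
    fix x y assume "x \<in> \<Lambda>" "y \<in> \<Lambda>"
    then show "x \<otimes>\<^bsub>dual_lattice \<Lambda> B\<^esub> y \<in> \<Lambda>"
      using lattice_diff[of x "0 - y"] lattice_diff[OF 0, of y] by (simp add: dual_lattice_def)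
  qed (use lattice_subset_dual 0 in auto)
qed

end

section \<open>The obstruction to lifting and the conclusion\<close>

text \<open>The unique element \<open>a\<close> of order 2 pulls back to a dual vector of integral
  norm, so the rank of a lift would be odd, and with it the signature. Congruence modulo 8 preserves
  parity, contradicting even \<open>C\<close>.\<close>

lemma not_lifts_if_2_torsion_order_2:
  assumes D: "group D" and a: "a \<in> carrier D" "a \<noteq> \<one>\<^bsub>D\<^esub>" "a \<otimes>\<^bsub>D\<^esub> a = \<one>\<^bsub>D\<^esub>"
    and tors: "\<And>x. x \<in> carrier D \<Longrightarrow> x \<otimes>\<^bsub>D\<^esub> x = \<one>\<^bsub>D\<^esub> \<Longrightarrow> x = \<one>\<^bsub>D\<^esub> \<or> x = a"
    and qa: "assoc_form D q a a = 0" and "even C"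
  shows "\<not> lifts_to_even_lattice D q C"
proof
  assume "lifts_to_even_lattice D q C"
  then obtain \<Lambda> B s \<phi> where lat: "even_lattice \<Lambda> B" and sig: "has_signature \<Lambda> B s"
    and sC: "s mod 8 = C mod 8" and iso: "\<phi> \<in> iso (discriminant_group \<Lambda> B) D"
    and form: "\<And>v w. v \<in> carrier (dual_lattice \<Lambda> B) \<Longrightarrow> w \<in> carrier (dual_lattice \<Lambda> B) \<Longrightarrow>
        assoc_form D q (\<phi> (\<Lambda> #>\<^bsub>dual_lattice \<Lambda> B\<^esub> v)) (\<phi> (\<Lambda> #>\<^bsub>dual_lattice \<Lambda> B\<^esub> w)) =
        rat_class (B v w)"
    unfolding lifts_to_even_lattice_def by blast
  obtain S where "finite S" "rat_space.independent S"
    "\<Lambda> = {\<Sum>s\<in>S. rat_scale (of_int (c s)) s | c :: rat_space \<Rightarrow> int. True}"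
    using lat unfolding even_lattice_def free_fg_group_def by blast
  then interpret L: even_lattice_basis \<Lambda> B S using lat by unfold_locales
  let ?G = "dual_lattice \<Lambda> B"
  interpret D: group D by (rule D)
  interpret G: comm_group ?G by (rule L.comm_group_dual)
  interpret N: normal \<Lambda> ?G by (rule L.normal_lattice)
  \<comment> \<open>Composing with the projection replaces cosets by dual vectors:
    \<open>\<psi>\<close> is a homomorphism onto \<open>D\<close> with kernel
    \<open>\<Lambda>\<close>.\<close>
  define \<psi> where "\<psi> = (\<lambda>v. \<phi> (\<Lambda> #>\<^bsub>?G\<^esub> v))"
  have hom: "\<phi> \<in> hom (?G Mod \<Lambda>) D" and bij: "bij_betw \<phi> (carrier (?G Mod \<Lambda>)) (carrier D)"
    using iso by (auto simp: iso_def discriminant_group_def)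
  have \<psi>_hom: "\<psi> \<in> hom ?G D"
    using hom_compose[OF N.r_coset_hom_Mod hom] by (simp add: \<psi>_def comp_def)
  have \<psi>_add: "\<psi> (v + w) = \<psi> v \<otimes>\<^bsub>D\<^esub> \<psi> w" if "v \<in> carrier ?G" "w \<in> carrier ?G" for v w
    using hom_mult[OF \<psi>_hom that] by (simp add: dual_lattice_def)
  have \<psi>_closed: "\<psi> v \<in> carrier D" if "v \<in> carrier ?G" for v
    using \<psi>_hom that by (auto simp: hom_def)
  have \<psi>_one: "\<psi> v = \<one>\<^bsub>D\<^esub> \<longleftrightarrow> v \<in> \<Lambda>" if v: "v \<in> carrier ?G" for v
  proof -
    have coset: "\<Lambda> #>\<^bsub>?G\<^esub> v \<in> carrier (?G Mod \<Lambda>)"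
      using v by (auto simp: FactGroup_def RCOSETS_def)
    have one: "\<phi> \<Lambda> = \<one>\<^bsub>D\<^esub>"
      using hom_one[OF hom N.factorgroup_is_group D] by (simp add: FactGroup_def)
    have mem: "\<Lambda> \<in> carrier (?G Mod \<Lambda>)"
      using group.is_monoid[OF N.factorgroup_is_group] monoid.one_closed
      by (metis one_FactGroup)
    have "\<psi> v = \<one>\<^bsub>D\<^esub> \<longleftrightarrow> \<Lambda> #>\<^bsub>?G\<^esub> v = \<Lambda>"
      using inj_on_eq_iff[OF bij_betw_imp_inj_on[OF bij] coset mem] one by (simp add: \<psi>_def)
    also have "\<dots> \<longleftrightarrow> v \<in> \<Lambda>"
      using G.coset_join1 G.coset_join2 v N.subgroup_axioms by blast
    finally show ?thesis .
  qed
  have "a \<in> \<phi> ` carrier (?G Mod \<Lambda>)" using bij a by (simp add: bij_betw_def)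
  then obtain v where v: "v \<in> carrier ?G" "\<psi> v = a"
    by (auto simp: \<psi>_def FactGroup_def RCOSETS_def)
  have "v + v \<in> carrier ?G" if "v \<in> carrier ?G" for v
    using G.m_closed[OF that that] by (simp add: dual_lattice_def)
  then have double: "v + v \<in> \<Lambda> \<longleftrightarrow> \<psi> v \<otimes>\<^bsub>D\<^esub> \<psi> v = \<one>\<^bsub>D\<^esub>" if "v \<in> carrier ?G" for v
    using \<psi>_one[of "v + v"] \<psi>_add[OF that that] that by simp
  have "odd (card S)"
  proof (rule L.odd_rank_if_2_torsion_order_2)
    show "v \<in> carrier ?G" "v \<notin> \<Lambda>" "v + v \<in> \<Lambda>"
      using v a \<psi>_one double by auto
    show "B v v \<in> \<int>"
      using form[OF v(1) v(1)] v(2) qa by (simp add: \<psi>_def rat_class_eq_0_iff)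
    fix w assume w: "w \<in> carrier ?G" "w + w \<in> \<Lambda>"
    then consider "\<psi> w = \<one>\<^bsub>D\<^esub>" | "\<psi> w = a" using tors \<psi>_closed double by blast
    then show "w \<in> \<Lambda> \<or> w - v \<in> \<Lambda>"
    proof cases
      case 1
      then show ?thesis using \<psi>_one w by simp
    next
      case 2
      have wv: "w - v \<in> carrier ?G" using w(1) v(1) by (rule L.dual_diff)
      \<comment> \<open>Additivity applies to w = (w - v) + v, and both \<open>v\<close> and
        \<open>w\<close> map to \<open>a\<close>; cancelling \<open>a\<close> puts
        \<open>w - v\<close> in the kernel.\<close>
      then have "\<psi> (w - v) \<otimes>\<^bsub>D\<^esub> a = a"
        using \<psi>_add[OF wv v(1)] v(2) 2 by simp
      then have "\<psi> (w - v) = \<one>\<^bsub>D\<^esub>" using a \<psi>_closed[OF wv] by (simp add: D.r_cancel_one)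
      then show ?thesis using \<psi>_one wv by simp
    qed
  qed
  then have "odd s" using L.signature_parity[OF sig] by simp
  moreover have "even s" using sC \<open>even C\<close> by presburger
  ultimately show False by simp
qed

theorem propositionA4:
  "(\<exists>(D :: nat monoid) (q :: nat \<Rightarrow> rat_mod_int).
      finite_abelian_group D \<and> generalized_quadratic_form D q \<and> q \<one>\<^bsub>D\<^esub> = 0 \<and>
      \<not> pure_quadratic_form D q) \<and>
   (\<exists>(D :: nat monoid) (q :: nat \<Rightarrow> rat_mod_int) (C :: int).
      finite_abelian_group D \<and> generalized_quadratic_form D q \<and> q \<one>\<^bsub>D\<^esub> = 0 \<and>
      gauss_sum_formula D q C \<and> \<not> lifts_to_even_lattice D q C)"
proof -
  have fin: "finite_abelian_group Z4"
    by (simp add: finite_abelian_group_def comm_group_Z4)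
  have q0: "q4 \<one>\<^bsub>Z4\<^esub> = 0"
    by (simp add: q4_def rat_class_eq_0_iff)
  have "\<not> lifts_to_even_lattice Z4 q4 0"
  \<comment> \<open>The element of order 2 is 2, and its self-pairing 4/4 is integral.\<close>
  proof (rule not_lifts_if_2_torsion_order_2[of Z4 2])
    show "group Z4" using comm_group_Z4 by (rule comm_group.axioms)
    show "assoc_form Z4 q4 2 2 = 0" by (simp add: assoc_form_q4 rat_class_eq_0_iff)
    fix x assume "x \<in> carrier Z4" "x \<otimes>\<^bsub>Z4\<^esub> x = \<one>\<^bsub>Z4\<^esub>"
    then show "x = \<one>\<^bsub>Z4\<^esub> \<or> x = 2" by simp presburger
  qed simp_all
  then show ?thesis
    using fin q0 generalized_quadratic_form_q4 not_pure_q4 gauss_sum_q4 by blast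
qed

end
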